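(* The Kauffman monoids $\mathcal{K}_3$ and $\mathcal{K}_4$ are equationally equivalent; that is, for all words $w,w'\in X^+$, the identity $w\bumpeq w'$ holds in $\mathcal{K}_3$ if and only if it holds in $\mathcal{K}_4$.
   Context: For an integer $n\ge 2$, the Kauffman monoid $\mathcal{K}_n$ is the monoid presented by generators $c,h_1,\dots,h_{n-1}$ subject to the relations: $h_ih_j=h_jh_i$ if $|i-j|\ge 2$, $i,j=1,\dots,n-1$; $h_ih_jh_i=h_i$ if $|i-j|=1$, $i,j=1,\dots,n-1$; $h_i^2=ch_i=h_ic$ for each $i=1,\dots,n-1$. $X$ is a fixed countably infinite set (alphabet) and $X^+$ is the free semigroup over $X$, i.e. the set of nonempty finite words over $X$ under concatenation. An identity is an expression $w\bumpeq w'$ with $w,w'\in X^+$. It holds in a semigroup $\mathcal{S}$ if $w\varphi=w'\varphi$ for every semigroup homomorphism $\varphi\colon X^+\to\mathcal{S}$ (equivalently, for every substitution of elements of $\mathcal{S}$ for the letters). Two semigroups are equationally equivalent if they satisfy the same identities. *)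

theory Defs
  imports "HOL-Algebra.Group" "HOL-Library.Countable_Set"
begin

inductive_set pres_cong :: "'g set \<Rightarrow> ('g list \<times> 'g list) set \<Rightarrow> ('g list \<times> 'g list) set"
  for A :: "'g set" and R :: "('g list \<times> 'g list) set"
where
  base: "(u, v) \<in> R \<Longrightarrow> u \<in> lists A \<Longrightarrow> v \<in> lists A \<Longrightarrow> (u, v) \<in> pres_cong A R"
| refl: "u \<in> lists A \<Longrightarrow> (u, u) \<in> pres_cong A R"
| sym: "(u, v) \<in> pres_cong A R \<Longrightarrow> (v, u) \<in> pres_cong A R"
| trans: "(u, v) \<in> pres_cong A R \<Longrightarrow> (v, w) \<in> pres_cong A R \<Longrightarrow> (u, w) \<in> pres_cong A R"
| mult: "(u, v) \<in> pres_cong A R \<Longrightarrow> (u', v') \<in> pres_cong A R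
    \<Longrightarrow> (u @ u', v @ v') \<in> pres_cong A R"

definition presented_monoid :: "'g set \<Rightarrow> ('g list \<times> 'g list) set \<Rightarrow> 'g list set monoid" where
  "presented_monoid A R =
    \<lparr>carrier = lists A // pres_cong A R,
     mult = (\<lambda>U V. \<Union>u\<in>U. \<Union>v\<in>V. pres_cong A R `` {u @ v}),
     one = pres_cong A R `` {[]}\<rparr>"

lemma pres_cong_lists: "(u, v) \<in> pres_cong A R \<Longrightarrow> u \<in> lists A \<and> v \<in> lists A"
  by (induction rule: pres_cong.induct) auto

lemma equiv_pres_cong: "equiv (lists A) (pres_cong A R)"
proof (rule equivI)
  show "pres_cong A R \<subseteq> lists A \<times> lists A"
    using pres_cong_lists by fast
  show "refl_on (lists A) (pres_cong A R)"
    by (rule refl_onI) (rule pres_cong.refl)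
  show "sym (pres_cong A R)"
    by (rule symI) (rule pres_cong.sym)
  show "trans (pres_cong A R)"
    by (rule transI) (rule pres_cong.trans)
qed

lemma mult_presented_monoid:
  assumes "u \<in> lists A" "v \<in> lists A"
  shows "(pres_cong A R `` {u}) \<otimes>\<^bsub>presented_monoid A R\<^esub> (pres_cong A R `` {v})
    = pres_cong A R `` {u @ v}"
proof -
  have "pres_cong A R `` {a @ b} = pres_cong A R `` {u @ v}"
    if "a \<in> pres_cong A R `` {u}" "b \<in> pres_cong A R `` {v}" for a b
    using that equiv_class_eq[OF equiv_pres_cong] pres_cong.mult by fastforce
  moreover have "u \<in> pres_cong A R `` {u}" "v \<in> pres_cong A R `` {v}"
    by (simp_all only: Image_singleton_iff assms pres_cong.refl)
  ultimately show ?thesis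
    unfolding presented_monoid_def monoid.simps by blast
qed

lemma monoid_presented_monoid: "monoid (presented_monoid A R)"
proof -
  have carr: "carrier (presented_monoid A R) = (\<lambda>u. pres_cong A R `` {u}) ` lists A"
    by (auto simp: presented_monoid_def quotient_def)
  have one: "\<one>\<^bsub>presented_monoid A R\<^esub> = pres_cong A R `` {[]}"
    by (simp add: presented_monoid_def)
  have app: "u @ v \<in> lists A" if "u \<in> lists A" "v \<in> lists A" for u v
    using that by simp
  have cls: "pres_cong A R `` {u} \<in> (\<lambda>u. pres_cong A R `` {u}) ` lists A" if "u \<in> lists A" for u
    using that by (rule imageI)
  show ?thesis
    by (rule monoidI; unfold carr one; (elim imageE)?; hypsubst?)
       (simp_all only: mult_presented_monoid app lists.Nil append_assoc append_Nil append_Nil2 cls)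
qed

datatype kauffman_gen = C | H nat

definition kauffman_gens :: "nat \<Rightarrow> kauffman_gen set" where
  "kauffman_gens n = insert C (H ` {1..n - 1})"

definition kauffman_rels :: "nat \<Rightarrow> (kauffman_gen list \<times> kauffman_gen list) set" where
  "kauffman_rels n =
    {([H i, H j], [H j, H i]) | i j. i \<in> {1..n - 1} \<and> j \<in> {1..n - 1} \<and> \<bar>int i - int j\<bar> \<ge> 2}
  \<union> {([H i, H j, H i], [H i]) | i j. i \<in> {1..n - 1} \<and> j \<in> {1..n - 1} \<and> \<bar>int i - int j\<bar> = 1}
  \<union> {([H i, H i], [C, H i]) | i. i \<in> {1..n - 1}}
  \<union> {([C, H i], [H i, C]) | i. i \<in> {1..n - 1}}"

definition kauffman_monoid :: "nat \<Rightarrow> kauffman_gen list set monoid" where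
  "kauffman_monoid n = presented_monoid (kauffman_gens n) (kauffman_rels n)"

(* The record type requires a unit field; the value is irrelevant, since [] lies outside the
   carrier and hom does not mention units, so hom is the set of semigroup homomorphisms. *)
definition free_semigroup :: "'x set \<Rightarrow> 'x list monoid" where
  "free_semigroup X = \<lparr>carrier = lists X - {[]}, mult = (@), one = []\<rparr>"

definition identity_holds :: "'x set \<Rightarrow> ('a, 'b) monoid_scheme \<Rightarrow> 'x list \<Rightarrow> 'x list \<Rightarrow> bool" where
  "identity_holds X S w w' \<longleftrightarrow> (\<forall>\<phi> \<in> hom (free_semigroup X) S. \<phi> w = \<phi> w')"

definition equationally_equivalent ::
  "'x set \<Rightarrow> ('a, 'c) monoid_scheme \<Rightarrow> ('b, 'd) monoid_scheme \<Rightarrow> bool" where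
  "equationally_equivalent X S T \<longleftrightarrow>
    (\<forall>w \<in> carrier (free_semigroup X). \<forall>w' \<in> carrier (free_semigroup X).
      identity_holds X S w w' \<longleftrightarrow> identity_holds X T w w')"

end

theory Submission
  imports Defs
begin

text \<open>
  Write \<open>K\<^sub>3\<close> and \<open>K\<^sub>4\<close> for the two monoids. The proof is a cycle of three inclusions between
  sets of identities: from \<open>K\<^sub>4\<close> to \<open>K\<^sub>3\<close>, from \<open>K\<^sub>3\<close> to a concrete model \<open>M\<close>, and from \<open>M\<close> back to \<open>K\<^sub>4\<close>.

  Sending \<open>h\<^sub>3\<close> to \<open>h\<^sub>1\<close> respects the relations, so \<open>K\<^sub>3\<close> is a homomorphic image of \<open>K\<^sub>4\<close> and inherits
  its identities (\<open>identity_holds_K4_imp_K3\<close>). In turn \<open>K\<^sub>3\<close> maps onto \<open>M\<close>, which consists of the powers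
  of a central \<open>c\<close> and of a two-by-two Rees matrix semigroup over these powers, in which two adjacent
  factors contribute an extra \<open>c\<close> exactly when their inner indices agree
  (\<open>identity_holds_K3_imp_cell_monoid\<close>).

  The substance is the remaining inclusion (\<open>identity_holds_cell_monoid_imp_K4\<close>). Up to powers of \<open>c\<close>,
  an element of \<open>K\<^sub>4\<close> is the identity, or one of nine diagrams given by the position of the only
  hook at the top and at the bottom, or one of four diagrams without through strands. Folding \<open>h\<^sub>3\<close>
  onto \<open>h\<^sub>1\<close> identifies no two diagrams without through strands. Hence, given the identities of \<open>M\<close>,
  it is enough to know whether the value of a word in \<open>K\<^sub>4\<close> has through strands and, if it has, where
  its outer hooks are. The outer hooks are visible in \<open>M\<close> after relabelling the three hook positions
  by two indices. Through strands disappear exactly if some letter has none or if, after deleting the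
  letters whose values are powers of \<open>c\<close>, a left hook meets a right one. The number of such adjacent pairs can be
  computed from exponents of \<open>c\<close> in \<open>M\<close>: if \<open>h\<close> and \<open>g\<close> are the truth values labelling the two inner
  indices, then \<open>[h = g] + 1 - [h] - [g]\<close> is \<open>2\<close> if both are false and \<open>0\<close> otherwise, and each of these
  four terms counts index agreements for a suitable labelling.

  In algebraic terms, finitely many coordinates suffice to exhibit \<open>K\<^sub>4\<close> as a divisor of a power of
  \<open>M\<close>. Identities pass to divisors of powers (\<open>identity_holds_divisor\<close>), and the
  divisor is given by the relation \<open>reads\<close>, which is multiplicative and determines the diagram.
\<close>

section \<open>Evaluating words and transferring identities\<close>

definition word_eval :: "('a, 'm) monoid_scheme \<Rightarrow> ('g \<Rightarrow> 'a) \<Rightarrow> 'g list \<Rightarrow> 'a" where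
  "word_eval G f u = foldr (\<lambda>g y. f g \<otimes>\<^bsub>G\<^esub> y) u \<one>\<^bsub>G\<^esub>"

lemma word_eval_Nil [simp]: "word_eval G f [] = \<one>\<^bsub>G\<^esub>"
  and word_eval_Cons [simp]: "word_eval G f (g # u) = f g \<otimes>\<^bsub>G\<^esub> word_eval G f u"
  by (simp_all add: word_eval_def)

context monoid
begin

lemma word_eval_closed: "f \<in> A \<rightarrow> carrier G \<Longrightarrow> u \<in> lists A \<Longrightarrow> word_eval G f u \<in> carrier G"
  by (induction u) auto

lemma word_eval_append:
  assumes "f \<in> A \<rightarrow> carrier G" "u \<in> lists A" "v \<in> lists A"
  shows "word_eval G f (u @ v) = word_eval G f u \<otimes> word_eval G f v"
  using assms(2)
proof (induction u)
  case Nil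
  then show ?case using word_eval_closed[OF assms(1,3)] by simp
next
  case (Cons g u)
  then show ?case
    using word_eval_closed[OF assms(1,3)] word_eval_closed[OF assms(1)] assms(1)
    by (auto simp: m_assoc Pi_iff)
qed

lemma word_eval_hom_free_semigroup:
  assumes "f \<in> X \<rightarrow> carrier G"
  shows "word_eval G f \<in> hom (free_semigroup X) G"
  using word_eval_closed[OF assms] word_eval_append[OF assms]
  by (auto simp: hom_def free_semigroup_def)

end

text \<open>
  One half of Birkhoff's theorem: the relation \<open>R\<close> is the graph of a map onto \<open>T\<close> from a
  subsemigroup of the power of \<open>S\<close> with index type \<open>'i\<close>. An assignment in \<open>T\<close> is lifted letter by letter
  to that subsemigroup, where an identity can be checked in every coordinate.
\<close>
lemma identity_holds_divisor:
  fixes S :: "('a, 'm) monoid_scheme" and T :: "('b, 'n) monoid_scheme"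
    and R :: "'b \<Rightarrow> ('i \<Rightarrow> 'a) \<Rightarrow> bool"
  assumes S: "monoid S"
    and carr: "\<And>t r i. R t r \<Longrightarrow> r i \<in> carrier S"
    and total: "\<And>t. t \<in> carrier T \<Longrightarrow> \<exists>r. R t r"
    and mult: "\<And>t t' r r'. R t r \<Longrightarrow> R t' r' \<Longrightarrow> R (t \<otimes>\<^bsub>T\<^esub> t') (\<lambda>i. r i \<otimes>\<^bsub>S\<^esub> r' i)"
    and functional: "\<And>t t' r. R t r \<Longrightarrow> R t' r \<Longrightarrow> t = t'"
    and w: "w \<in> carrier (free_semigroup X)" "w' \<in> carrier (free_semigroup X)"
    and holds: "identity_holds X S w w'"
  shows "identity_holds X T w w'"
  unfolding identity_holds_def
proof
  interpret S: monoid S by (rule S)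
  fix \<phi> assume \<phi>: "\<phi> \<in> hom (free_semigroup X) T"
  have "\<exists>r. R (\<phi> [x]) r" if "x \<in> X" for x
    using \<phi> that by (intro total) (auto simp: hom_def free_semigroup_def)
  then obtain \<rho> where \<rho>: "\<And>x. x \<in> X \<Longrightarrow> R (\<phi> [x]) (\<rho> x)" by metis
  define \<psi> where "\<psi> = (\<lambda>i. word_eval S (\<lambda>x. \<rho> x i))"
  have fn: "(\<lambda>x. \<rho> x i) \<in> X \<rightarrow> carrier S" for i
    using carr \<rho> by blast
  have related: "R (\<phi> v) (\<lambda>i. \<psi> i v)" if "v \<noteq> []" "v \<in> lists X" for v
    using that
  proof (induction v rule: list_nonempty_induct)
    case (single x)
    moreover have "(\<lambda>i. \<psi> i [x]) = \<rho> x"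
      using carr \<rho> single by (fastforce simp: \<psi>_def)
    ultimately show ?case using \<rho> by simp
  next
    case (cons x v)
    have "\<phi> ([x] @ v) = \<phi> [x] \<otimes>\<^bsub>T\<^esub> \<phi> v"
      using hom_mult[OF \<phi>, of "[x]" v] cons by (simp add: free_semigroup_def)
    then show ?case
      using mult[OF \<rho>[of x] cons.IH] cons.prems by (simp add: \<psi>_def)
  qed
  have "\<psi> i w = \<psi> i w'" for i
    using holds S.word_eval_hom_free_semigroup[OF fn]
    by (auto simp: identity_holds_def \<psi>_def)
  then show "\<phi> w = \<phi> w'"
    using related[of w] related[of w'] w functional by (auto simp: free_semigroup_def)
qed

section \<open>Homomorphisms out of a presented monoid\<close>

abbreviation word_class :: "'g set \<Rightarrow> ('g list \<times> 'g list) set \<Rightarrow> 'g list \<Rightarrow> 'g list set" where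
  "word_class A R u \<equiv> pres_cong A R `` {u}"

lemma word_class_eq_iff:
  "u \<in> lists A \<Longrightarrow> v \<in> lists A \<Longrightarrow> word_class A R u = word_class A R v \<longleftrightarrow> (u, v) \<in> pres_cong A R"
  using eq_equiv_class_iff[OF equiv_pres_cong] .

lemma carrier_presented_monoid:
  "carrier (presented_monoid A R) = word_class A R ` lists A"
  by (auto simp: presented_monoid_def quotient_def)

lemma one_presented_monoid: "\<one>\<^bsub>presented_monoid A R\<^esub> = word_class A R []"
  by (simp add: presented_monoid_def)

lemma word_eval_generators:
  "u \<in> lists A \<Longrightarrow> word_eval (presented_monoid A R) (\<lambda>g. word_class A R [g]) u = word_class A R u"
  by (induction u) (auto simp: one_presented_monoid mult_presented_monoid)

lemma presented_relation:
  assumes "(u, v) \<in> R" "u \<in> lists A" "v \<in> lists A"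
  shows "word_eval (presented_monoid A R) (\<lambda>g. word_class A R [g]) u =
    word_eval (presented_monoid A R) (\<lambda>g. word_class A R [g]) v"
  using assms pres_cong.base[OF assms] by (simp add: word_eval_generators word_class_eq_iff)

lemma (in monoid) word_eval_respects_pres_cong:
  assumes f: "f \<in> A \<rightarrow> carrier G"
    and rels: "\<And>u v. (u, v) \<in> R \<Longrightarrow> u \<in> lists A \<Longrightarrow> v \<in> lists A \<Longrightarrow> word_eval G f u = word_eval G f v"
    and "(u, v) \<in> pres_cong A R"
  shows "word_eval G f u = word_eval G f v"
  using assms(3)
proof (induction rule: pres_cong.induct)
  case (mult u v u' v')
  then show ?case
    using word_eval_append[OF f] pres_cong_lists by metis
qed (use rels in auto)

text \<open>
  By von Dyck's theorem such an \<open>f\<close> induces a homomorphism from the presented monoid onto \<open>M\<close>; its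
  converse graph serves as the divisor relation, with a single coordinate.
\<close>
lemma identity_holds_presented_image:
  fixes M :: "('a, 'm) monoid_scheme"
  assumes M: "monoid M"
    and f: "f \<in> A \<rightarrow> carrier M"
    and rels: "\<And>u v. (u, v) \<in> R \<Longrightarrow> u \<in> lists A \<Longrightarrow> v \<in> lists A \<Longrightarrow> word_eval M f u = word_eval M f v"
    and surj: "\<And>m. m \<in> carrier M \<Longrightarrow> \<exists>u \<in> lists A. word_eval M f u = m"
    and w: "w \<in> carrier (free_semigroup X)" "w' \<in> carrier (free_semigroup X)"
    and holds: "identity_holds X (presented_monoid A R) w w'"
  shows "identity_holds X M w w'"
proof -
  interpret M: monoid M by (rule M)
  let ?rel = "\<lambda>m (r :: unit \<Rightarrow> 'b list set). \<exists>u \<in> lists A. r () = word_class A R u \<and> m = word_eval M f u"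
  show ?thesis
  proof (rule identity_holds_divisor[where R = ?rel, OF monoid_presented_monoid _ _ _ _ w holds])
    fix t t' :: 'a and r r' :: "unit \<Rightarrow> 'b list set"
    assume "?rel t r" "?rel t' r'"
    then obtain u u' where "u \<in> lists A" "u' \<in> lists A" "r () = word_class A R u"
      "r' () = word_class A R u'" "t = word_eval M f u" "t' = word_eval M f u'"
      by blast
    then show "?rel (t \<otimes>\<^bsub>M\<^esub> t') (\<lambda>i. r i \<otimes>\<^bsub>presented_monoid A R\<^esub> r' i)"
      by (intro bexI[of _ "u @ u'"]) (simp_all add: mult_presented_monoid M.word_eval_append[OF f])
  next
    fix t t' :: 'a and r :: "unit \<Rightarrow> 'b list set"
    assume "?rel t r" "?rel t' r"
    then show "t = t'"
      using M.word_eval_respects_pres_cong[OF f rels] word_class_eq_iff by metis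
  next
    fix t :: 'a and r :: "unit \<Rightarrow> 'b list set" and i
    assume "?rel t r"
    then show "r i \<in> carrier (presented_monoid A R)"
      by (cases i) (auto simp: carrier_presented_monoid)
  next
    fix t assume "t \<in> carrier M"
    then obtain u where "u \<in> lists A" "word_eval M f u = t"
      using surj by blast
    then show "\<exists>r. ?rel t r"
      by (intro exI[of _ "\<lambda>_. word_class A R u"]) auto
  qed
qed

abbreviation gen_class :: "nat \<Rightarrow> kauffman_gen \<Rightarrow> kauffman_gen list set" where
  "gen_class n g \<equiv> word_class (kauffman_gens n) (kauffman_rels n) [g]"

lemma monoid_kauffman_monoid: "monoid (kauffman_monoid n)"
  unfolding kauffman_monoid_def by (rule monoid_presented_monoid)

lemma gen_class_closed:
  "g \<in> kauffman_gens n \<Longrightarrow> gen_class n g \<in> carrier (kauffman_monoid n)"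
  by (auto simp: kauffman_monoid_def carrier_presented_monoid)

lemma kauffman_relation:
  assumes "(u, v) \<in> kauffman_rels n"
  shows "word_eval (kauffman_monoid n) (gen_class n) u = word_eval (kauffman_monoid n) (gen_class n) v"
  unfolding kauffman_monoid_def using assms
  by (intro presented_relation) (auto simp: kauffman_rels_def kauffman_gens_def)

section \<open>Folding the third hook onto the first\<close>

text \<open>
  The defining relations as equations between elements, so that computations can be carried out in
  an arbitrary monoid without referring to congruence classes of words.
\<close>
locale kauffman_relations = monoid K for K (structure) +
  fixes n :: nat and c :: 'a and h :: "nat \<Rightarrow> 'a"
  assumes c_closed [simp]: "c \<in> carrier K"
    and h_closed [simp]: "i \<in> {1..n - 1} \<Longrightarrow> h i \<in> carrier K"
    and h_commute: "i \<in> {1..n - 1} \<Longrightarrow> j \<in> {1..n - 1} \<Longrightarrow> \<bar>int i - int j\<bar> \<ge> 2 \<Longrightarrow> h i \<otimes> h j = h j \<otimes> h i"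
    and h_cancel: "i \<in> {1..n - 1} \<Longrightarrow> j \<in> {1..n - 1} \<Longrightarrow> \<bar>int i - int j\<bar> = 1 \<Longrightarrow> h i \<otimes> (h j \<otimes> h i) = h i"
    and h_square: "i \<in> {1..n - 1} \<Longrightarrow> h i \<otimes> h i = c \<otimes> h i"
    and h_c: "i \<in> {1..n - 1} \<Longrightarrow> h i \<otimes> c = c \<otimes> h i"

lemma kauffman_relations_kauffman_monoid:
  "kauffman_relations (kauffman_monoid n) n (gen_class n C) (\<lambda>i. gen_class n (H i))"
proof -
  interpret monoid "kauffman_monoid n" by (rule monoid_kauffman_monoid)
  have cl: "gen_class n C \<in> carrier (kauffman_monoid n)"
    "\<And>i. i \<in> {1..n - 1} \<Longrightarrow> gen_class n (H i) \<in> carrier (kauffman_monoid n)"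
    by (rule gen_class_closed, simp add: kauffman_gens_def)+
  note rel = kauffman_relation[of _ _ n]
  have in_rels:
    "\<lbrakk>i \<in> {1..n - 1}; j \<in> {1..n - 1}; \<bar>int i - int j\<bar> \<ge> 2\<rbrakk> \<Longrightarrow> ([H i, H j], [H j, H i]) \<in> kauffman_rels n"
    "\<lbrakk>i \<in> {1..n - 1}; j \<in> {1..n - 1}; \<bar>int i - int j\<bar> = 1\<rbrakk> \<Longrightarrow> ([H i, H j, H i], [H i]) \<in> kauffman_rels n"
    "i \<in> {1..n - 1} \<Longrightarrow> ([H i, H i], [C, H i]) \<in> kauffman_rels n"
    "i \<in> {1..n - 1} \<Longrightarrow> ([C, H i], [H i, C]) \<in> kauffman_rels n" for i j
    unfolding kauffman_rels_def by blast+
  show ?thesis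
  proof
    fix i j assume ij: "i \<in> {1..n - 1}" "j \<in> {1..n - 1}"
    show "gen_class n (H i) \<otimes>\<^bsub>kauffman_monoid n\<^esub> gen_class n (H j) =
        gen_class n (H j) \<otimes>\<^bsub>kauffman_monoid n\<^esub> gen_class n (H i)" if "\<bar>int i - int j\<bar> \<ge> 2"
      using rel[of "[H i, H j]" "[H j, H i]"] ij that cl in_rels by simp
    show "gen_class n (H i) \<otimes>\<^bsub>kauffman_monoid n\<^esub>
        (gen_class n (H j) \<otimes>\<^bsub>kauffman_monoid n\<^esub> gen_class n (H i)) = gen_class n (H i)"
      if "\<bar>int i - int j\<bar> = 1"
      using rel[of "[H i, H j, H i]" "[H i]"] ij that cl in_rels by simp
  next
    fix i assume i: "i \<in> {1..n - 1}"
    show "gen_class n (H i) \<otimes>\<^bsub>kauffman_monoid n\<^esub> gen_class n (H i) =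
        gen_class n C \<otimes>\<^bsub>kauffman_monoid n\<^esub> gen_class n (H i)"
      using rel[of "[H i, H i]" "[C, H i]"] i cl in_rels by simp
    show "gen_class n (H i) \<otimes>\<^bsub>kauffman_monoid n\<^esub> gen_class n C =
        gen_class n C \<otimes>\<^bsub>kauffman_monoid n\<^esub> gen_class n (H i)"
      using rel[of "[C, H i]" "[H i, C]"] i cl in_rels by simp
  qed (use cl in auto)
qed

lemma index_less_4: "i \<in> {1..4 - 1} \<longleftrightarrow> i = 1 \<or> i = 2 \<or> i = (3::nat)"
  and index_less_3: "i \<in> {1..3 - 1} \<longleftrightarrow> i = 1 \<or> i = (2::nat)"
  by auto

lemma identity_holds_K4_imp_K3:
  assumes w: "w \<in> carrier (free_semigroup X)" "w' \<in> carrier (free_semigroup X)"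
    and holds: "identity_holds X (kauffman_monoid 4) w w'"
  shows "identity_holds X (kauffman_monoid 3) w w'"
proof -
  interpret kauffman_relations "kauffman_monoid 3" 3 "gen_class 3 C" "\<lambda>i. gen_class 3 (H i)"
    by (rule kauffman_relations_kauffman_monoid)
  define f where "f g = gen_class 3 (if g = H 3 then H 1 else g)" for g
  show ?thesis
  proof (rule identity_holds_presented_image[OF _ _ _ _ w holds[unfolded kauffman_monoid_def]])
    show "monoid (kauffman_monoid 3)" by (rule monoid_kauffman_monoid)
    show f: "f \<in> kauffman_gens 4 \<rightarrow> carrier (kauffman_monoid 3)"
    proof
      fix g assume "g \<in> kauffman_gens 4"
      then have "(if g = H 3 then H 1 else g) \<in> kauffman_gens 3"
        by (auto simp: kauffman_gens_def)
      then show "f g \<in> carrier (kauffman_monoid 3)"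
        unfolding f_def by (rule gen_class_closed)
    qed
    define c h1 h2 where gens: "c = gen_class 3 C" "h1 = gen_class 3 (H 1)" "h2 = gen_class 3 (H 2)"
    have f_gens: "f C = c" "f (H (Suc 0)) = h1" "f (H 2) = h2" "f (H 3) = h1"
      by (simp_all add: f_def gens)
    have closed: "c \<in> carrier (kauffman_monoid 3)" "h1 \<in> carrier (kauffman_monoid 3)"
      "h2 \<in> carrier (kauffman_monoid 3)"
      unfolding gens by (rule c_closed h_closed, simp)+
    have rels: "h1 \<otimes>\<^bsub>kauffman_monoid 3\<^esub> (h2 \<otimes>\<^bsub>kauffman_monoid 3\<^esub> h1) = h1"
      "h2 \<otimes>\<^bsub>kauffman_monoid 3\<^esub> (h1 \<otimes>\<^bsub>kauffman_monoid 3\<^esub> h2) = h2"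
      "h1 \<otimes>\<^bsub>kauffman_monoid 3\<^esub> h1 = c \<otimes>\<^bsub>kauffman_monoid 3\<^esub> h1"
      "h2 \<otimes>\<^bsub>kauffman_monoid 3\<^esub> h2 = c \<otimes>\<^bsub>kauffman_monoid 3\<^esub> h2"
      "h1 \<otimes>\<^bsub>kauffman_monoid 3\<^esub> c = c \<otimes>\<^bsub>kauffman_monoid 3\<^esub> h1"
      "h2 \<otimes>\<^bsub>kauffman_monoid 3\<^esub> c = c \<otimes>\<^bsub>kauffman_monoid 3\<^esub> h2"
      unfolding gens by (rule h_cancel h_square h_c; simp)+
    show "word_eval (kauffman_monoid 3) f u = word_eval (kauffman_monoid 3) f v"
      if "(u, v) \<in> kauffman_rels 4" for u v
      using that unfolding kauffman_rels_def index_less_4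
      by (elim UnE CollectE exE conjE disjE; simp add: f_gens closed rels)
    show "\<exists>u \<in> lists (kauffman_gens 4). word_eval (kauffman_monoid 3) f u = m"
      if "m \<in> carrier (kauffman_monoid 3)" for m
    proof -
      from that obtain u where u: "u \<in> lists (kauffman_gens 3)"
        "m = word_class (kauffman_gens 3) (kauffman_rels 3) u"
        by (auto simp: kauffman_monoid_def carrier_presented_monoid)
      have "word_eval (kauffman_monoid 3) f v = word_eval (kauffman_monoid 3) (gen_class 3) v"
        if "v \<in> lists (kauffman_gens 3)" for v
        using that by (induction v) (auto simp: f_def kauffman_gens_def)
      moreover have "u \<in> lists (kauffman_gens 4)"
        using u(1) by (auto simp: kauffman_gens_def)
      ultimately show ?thesis
        using u by (auto simp: kauffman_monoid_def word_eval_generators)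
    qed
  qed
qed

section \<open>The two-by-two Rees matrix model of the three-strand monoid\<close>

text \<open>
  \<open>Cell k a b\<close> is the diagram on three strands with \<open>k\<close> closed loops, whose top hook and bottom hook
  are at the positions \<open>a\<close> and \<open>b\<close>, where \<open>False\<close> stands for the first position and \<open>True\<close> for the
  second. Two equal hooks that meet close up to a new loop.
\<close>
datatype cell = Scalar nat | Cell nat bool bool

fun cell_mult :: "cell \<Rightarrow> cell \<Rightarrow> cell" where
  "cell_mult (Scalar k) (Scalar l) = Scalar (k + l)"
| "cell_mult (Scalar k) (Cell l a b) = Cell (k + l) a b"
| "cell_mult (Cell k a b) (Scalar l) = Cell (k + l) a b"
| "cell_mult (Cell k a b) (Cell l a' b') = Cell (k + l + of_bool (b = a')) a b'"

definition cell_monoid :: "cell monoid" where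
  "cell_monoid = \<lparr>carrier = UNIV, mult = cell_mult, one = Scalar 0\<rparr>"

lemma cell_monoid_simps [simp]:
  "carrier cell_monoid = UNIV" "mult cell_monoid = cell_mult" "one cell_monoid = Scalar 0"
  by (simp_all add: cell_monoid_def)

lemma cell_mult_assoc: "cell_mult (cell_mult x y) z = cell_mult x (cell_mult y z)"
  by (cases x; cases y; cases z) auto

lemma monoid_cell_monoid: "monoid cell_monoid"
proof (rule monoidI; simp add: cell_mult_assoc)
  show "cell_mult (Scalar 0) x = x" "cell_mult x (Scalar 0) = x" for x
    by (cases x, simp_all)+
qed

lemma identity_holds_K3_imp_cell_monoid:
  assumes w: "w \<in> carrier (free_semigroup X)" "w' \<in> carrier (free_semigroup X)"
    and holds: "identity_holds X (kauffman_monoid 3) w w'"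
  shows "identity_holds X cell_monoid w w'"
proof -
  define f where "f g = (case g of C \<Rightarrow> Scalar 1 | H i \<Rightarrow> Cell 0 (i = 2) (i = 2))" for g
  let ?eval = "word_eval cell_monoid f"
  \<comment> \<open>a word for \<open>Cell k a b\<close>: two different hooks multiply without a loop, and a doubled one would create a loop\<close>
  define hook where "hook b = H (if b then 2 else 1)" for b
  show ?thesis
  proof (rule identity_holds_presented_image[OF monoid_cell_monoid _ _ _ w holds[unfolded kauffman_monoid_def]])
    show "f \<in> kauffman_gens 3 \<rightarrow> carrier cell_monoid" by simp
    show "?eval u = ?eval v" if "(u, v) \<in> kauffman_rels 3" for u v
      using that unfolding kauffman_rels_def index_less_3 by (auto simp: f_def)
    show "\<exists>u \<in> lists (kauffman_gens 3). ?eval u = m" for m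
    proof -
      have scalars: "?eval (replicate k C @ u) = cell_mult (Scalar k) (?eval u)" for k u
      proof (induction k)
        case 0
        show ?case by (cases "?eval u") auto
      next
        case (Suc k)
        moreover have "f C = Scalar 1" by (simp add: f_def)
        ultimately show ?case by (simp add: cell_mult_assoc[symmetric])
      qed
      have "hook b \<in> kauffman_gens 3" "C \<in> kauffman_gens 3" for b
        by (auto simp: hook_def kauffman_gens_def)
      then have gens: "replicate k C @ (if a = b then [hook a] else [hook a, hook b]) \<in> lists (kauffman_gens 3)"
        "replicate k C \<in> lists (kauffman_gens 3)" for k a b
        by auto
      show ?thesis
      proof (cases m)
        case (Scalar k)
        then show ?thesis using scalars[of k "[]"] gens by (intro bexI[of _ "replicate k C"]) auto
      next
        case (Cell k a b)
        then show ?thesis using gens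
          by (intro bexI[of _ "replicate k C @ (if a = b then [hook a] else [hook a, hook b])"])
             (auto simp: scalars f_def hook_def)
      qed
    qed
  qed
qed

section \<open>Normal forms for the four-strand monoid\<close>

text \<open>
  \<open>Through k i j\<close> has \<open>k\<close> loops, one hook at the top in position \<open>i\<close>, one at the bottom in
  position \<open>j\<close>, and two through strands. \<open>Closed k a b\<close> has no through strand: each side carries
  two hooks, side by side for \<open>False\<close> and nested for \<open>True\<close>.
\<close>
datatype cap = CapL | CapM | CapR

datatype diagram = Loops nat | Through nat cap cap | Closed nat bool bool

definition opposite :: "cap \<Rightarrow> cap \<Rightarrow> bool" where
  "opposite j k \<longleftrightarrow> j = CapL \<and> k = CapR \<or> j = CapR \<and> k = CapL"

text \<open>
  The effect of folding the right hook onto the left one. It also says which pairing of the four end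
  points a hook belongs to: the two outer hooks to the parallel one, the middle hook to the nested one.
\<close>
abbreviation fold_cap :: "cap \<Rightarrow> bool" where
  "fold_cap i \<equiv> i = CapM"

text \<open>
  When opposite hooks meet, they turn back the two through strands on either side without closing a
  loop; two facing pairs of hooks always close one loop, and a second one if the pairings agree.
\<close>
fun diagram_mult :: "diagram \<Rightarrow> diagram \<Rightarrow> diagram" where
  "diagram_mult (Loops k) (Loops l) = Loops (k + l)"
| "diagram_mult (Loops k) (Through l i j) = Through (k + l) i j"
| "diagram_mult (Loops k) (Closed l a b) = Closed (k + l) a b"
| "diagram_mult (Through k i j) (Loops l) = Through (k + l) i j"
| "diagram_mult (Through k i j) (Through l i' j') =
    (if opposite j i' then Closed (k + l) (fold_cap i) (fold_cap j')
     else Through (k + l + of_bool (j = i')) i j')"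
| "diagram_mult (Through k i j) (Closed l a b) = Closed (k + l + of_bool (fold_cap j = a)) (fold_cap i) b"
| "diagram_mult (Closed k a b) (Loops l) = Closed (k + l) a b"
| "diagram_mult (Closed k a b) (Through l i j) = Closed (k + l + of_bool (b = fold_cap i)) a (fold_cap j)"
| "diagram_mult (Closed k a b) (Closed l a' b') = Closed (k + l + 1 + of_bool (b = a')) a b'"

locale four_strand_relations = monoid K for K (structure) +
  fixes c h1 h2 h3 :: 'a
  assumes closed [simp]: "c \<in> carrier K" "h1 \<in> carrier K" "h2 \<in> carrier K" "h3 \<in> carrier K"
    and far: "h3 \<otimes> h1 = h1 \<otimes> h3"
    and near: "h1 \<otimes> (h2 \<otimes> h1) = h1" "h2 \<otimes> (h1 \<otimes> h2) = h2"
      "h2 \<otimes> (h3 \<otimes> h2) = h2" "h3 \<otimes> (h2 \<otimes> h3) = h3"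
    and square: "h1 \<otimes> h1 = c \<otimes> h1" "h2 \<otimes> h2 = c \<otimes> h2" "h3 \<otimes> h3 = c \<otimes> h3"
    and central: "h1 \<otimes> c = c \<otimes> h1" "h2 \<otimes> c = c \<otimes> h2" "h3 \<otimes> c = c \<otimes> h3"
begin

lemma in_context:
  assumes "u \<otimes> v = w" "u \<in> carrier K" "v \<in> carrier K" "x \<in> carrier K"
  shows "u \<otimes> (v \<otimes> x) = w \<otimes> x"
  using assms by (simp add: m_assoc[symmetric])

lemma in_context3:
  assumes "u \<otimes> (v \<otimes> v') = w" "u \<in> carrier K" "v \<in> carrier K" "v' \<in> carrier K" "x \<in> carrier K"
  shows "u \<otimes> (v \<otimes> (v' \<otimes> x)) = w \<otimes> x"
  using assms by (metis m_assoc m_closed)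

lemma in_context4:
  assumes "u \<otimes> (v \<otimes> (v' \<otimes> v'')) = w" "u \<in> carrier K" "v \<in> carrier K" "v' \<in> carrier K"
    "v'' \<in> carrier K" "x \<in> carrier K"
  shows "u \<otimes> (v \<otimes> (v' \<otimes> (v'' \<otimes> x))) = w \<otimes> x"
  using assms by (metis m_assoc m_closed)

text \<open>
  The missing consequences of the relations when these are read as rewrite rules with \<open>h1\<close> to the left
  of \<open>h3\<close>: commuting \<open>h1\<close> with \<open>h3\<close> can hide an occurrence of \<open>h3 h2 h3\<close> or of \<open>h1 h2 h1\<close>.
\<close>
lemma overlaps:
  "h3 \<otimes> (h2 \<otimes> (h1 \<otimes> h3)) = h1 \<otimes> h3"
  "h1 \<otimes> (h3 \<otimes> (h2 \<otimes> h1)) = h1 \<otimes> h3"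
proof -
  have "h3 \<otimes> (h2 \<otimes> (h1 \<otimes> h3)) = (h3 \<otimes> (h2 \<otimes> h3)) \<otimes> h1"
    by (simp add: m_assoc far)
  then show "h3 \<otimes> (h2 \<otimes> (h1 \<otimes> h3)) = h1 \<otimes> h3"
    by (simp add: near far)
  have "h1 \<otimes> (h3 \<otimes> (h2 \<otimes> h1)) = (h1 \<otimes> h3) \<otimes> (h2 \<otimes> h1)"
    by (simp add: m_assoc)
  also have "\<dots> = h3 \<otimes> (h1 \<otimes> (h2 \<otimes> h1))"
    by (simp add: far[symmetric] m_assoc)
  finally show "h1 \<otimes> (h3 \<otimes> (h2 \<otimes> h1)) = h1 \<otimes> h3"
    by (simp add: near far)
qed

lemmas two_letter_rules = far square central
lemmas reductions = m_assoc two_letter_rules two_letter_rules[THEN in_context]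
  near near[THEN in_context3] overlaps overlaps[THEN in_context4]

text \<open>
  The nine diagrams with through strands factor through \<open>h2\<close>: since \<open>h1 h2 h1 = h1\<close> and \<open>h3 h2 h3 = h3\<close>,
  a top hook at the left, middle or right is produced by multiplying \<open>h2\<close> by \<open>h1\<close>, \<open>1\<close> or \<open>h3\<close>.
  In the same way, the four diagrams without through strands arise from \<open>h1 h3\<close>, since
  multiplication by \<open>h2\<close> turns the parallel hooks into nested ones.
\<close>
definition arm :: "cap \<Rightarrow> 'a" where
  "arm i = (case i of CapL \<Rightarrow> h1 | CapM \<Rightarrow> \<one> | CapR \<Rightarrow> h3)"

definition pocket :: "bool \<Rightarrow> 'a" where
  "pocket b = (if b then h2 else \<one>)"

definition through :: "cap \<Rightarrow> cap \<Rightarrow> 'a" where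
  "through i j = arm i \<otimes> (h2 \<otimes> arm j)"

definition capped :: "bool \<Rightarrow> bool \<Rightarrow> 'a" where
  "capped a b = pocket a \<otimes> (h1 \<otimes> (h3 \<otimes> pocket b))"

fun realize :: "diagram \<Rightarrow> 'a" where
  "realize (Loops k) = c [^] k"
| "realize (Through k i j) = c [^] k \<otimes> through i j"
| "realize (Closed k a b) = c [^] k \<otimes> capped a b"

lemma arm_closed [simp]: "arm i \<in> carrier K"
  by (cases i) (simp_all add: arm_def)

lemma through_closed [simp]: "through i j \<in> carrier K"
  by (simp add: through_def)

lemma capped_closed [simp]: "capped a b \<in> carrier K"
  by (simp add: capped_def pocket_def)

lemma through_through:
  "through i j \<otimes> through i' j' =
    (if opposite j i' then capped (fold_cap i) (fold_cap j')
     else c [^] (of_bool (j = i') :: nat) \<otimes> through i j')"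
  by (cases i; cases j; cases i'; cases j')
     (simp_all add: through_def capped_def pocket_def arm_def opposite_def reductions)

lemma through_capped:
  "through i j \<otimes> capped a b = c [^] (of_bool (fold_cap j = a) :: nat) \<otimes> capped (fold_cap i) b"
  by (cases i; cases j; cases a; cases b)
     (simp_all add: through_def capped_def pocket_def arm_def reductions)

lemma capped_through:
  "capped a b \<otimes> through i j = c [^] (of_bool (b = fold_cap i) :: nat) \<otimes> capped a (fold_cap j)"
  by (cases i; cases j; cases a; cases b)
     (simp_all add: through_def capped_def pocket_def arm_def reductions)

lemma capped_capped:
  "capped a b \<otimes> capped a' b' = c [^] (1 + of_bool (b = a') :: nat) \<otimes> capped a b'"
  by (cases a; cases b; cases a'; cases b')
     (simp_all add: capped_def pocket_def reductions)

lemma pow_central: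
  assumes "x \<in> carrier K" "x \<otimes> c = c \<otimes> x"
  shows "x \<otimes> c [^] (k :: nat) = c [^] k \<otimes> x"
  using assms
proof (induction k)
  case (Suc k)
  have "x \<otimes> (c [^] k \<otimes> c) = (x \<otimes> c [^] k) \<otimes> c"
    using Suc.prems by (simp add: m_assoc)
  also have "\<dots> = c [^] k \<otimes> c \<otimes> x"
    using Suc by (simp add: m_assoc)
  finally show ?case by simp
qed simp

lemma through_central: "through i j \<otimes> c [^] (k :: nat) = c [^] k \<otimes> through i j"
  and capped_central: "capped a b \<otimes> c [^] (k :: nat) = c [^] k \<otimes> capped a b"
  by (rule pow_central; cases i; cases j; cases a; cases b;
      simp add: through_def capped_def arm_def pocket_def reductions)+

lemma pull_scalars:
  assumes "x \<in> carrier K" "y \<in> carrier K" "\<And>l :: nat. x \<otimes> c [^] l = c [^] l \<otimes> x"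
  shows "(c [^] (k :: nat) \<otimes> x) \<otimes> (c [^] (l :: nat) \<otimes> y) = c [^] (k + l) \<otimes> (x \<otimes> y)"
proof -
  have "(c [^] k \<otimes> x) \<otimes> (c [^] l \<otimes> y) = c [^] k \<otimes> ((x \<otimes> c [^] l) \<otimes> y)"
    using assms(1,2) by (simp add: m_assoc)
  also have "\<dots> = c [^] (k + l) \<otimes> (x \<otimes> y)"
    using assms by (simp add: m_assoc nat_pow_mult[symmetric])
  finally show ?thesis .
qed

lemma add_scalars:
  "x \<in> carrier K \<Longrightarrow> c [^] (k :: nat) \<otimes> (c [^] (l :: nat) \<otimes> x) = c [^] (k + l) \<otimes> x"
  by (simp add: m_assoc[symmetric] nat_pow_mult)

text \<open>
  This makes the image of \<open>realize\<close> a submonoid. Since it contains the generators, every element of the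
  Kauffman monoid has a normal form.
\<close>
lemma realize_mult: "realize (diagram_mult s t) = realize s \<otimes> realize t"
proof (cases s)
  case (Loops k)
  then show ?thesis
    by (cases t) (simp_all add: add_scalars nat_pow_mult)
next
  case (Through k i j)
  then show ?thesis
    by (cases t) (simp_all add: pull_scalars pull_scalars[of _ \<one>, simplified] through_central
        through_through through_capped add_scalars)
next
  case (Closed k a b)
  then show ?thesis
    by (cases t) (simp_all add: pull_scalars pull_scalars[of _ \<one>, simplified] capped_central
        capped_through capped_capped add_scalars, simp add: m_assoc)
qed

lemma realize_closed [simp]: "realize t \<in> carrier K"
  by (cases t) simp_all

lemma generators_realized: "{c, h1, h2, h3} \<subseteq> range realize"
proof -
  have "c = realize (Loops 1)" "h1 = realize (Through 0 CapL CapL)"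
    "h2 = realize (Through 0 CapM CapM)" "h3 = realize (Through 0 CapR CapR)"
    by (simp_all add: through_def arm_def reductions)
  then show ?thesis by blast
qed

lemma word_eval_realized:
  assumes "\<And>g. g \<in> set u \<Longrightarrow> f g \<in> {c, h1, h2, h3}"
  shows "word_eval K f u \<in> range realize"
  using assms
proof (induction u)
  case Nil
  have "\<one> = realize (Loops 0)" by simp
  then show ?case by (metis rangeI word_eval_Nil)
next
  case (Cons g u)
  then have "word_eval K f u \<in> range realize" by simp
  moreover have "f g \<in> range realize"
    using Cons.prems[of g] generators_realized by auto
  ultimately show ?case
    by (auto simp: realize_mult[symmetric])
qed

end

lemma four_strand_relations_K4:
  "four_strand_relations (kauffman_monoid 4) (gen_class 4 C) (gen_class 4 (H 1))
    (gen_class 4 (H 2)) (gen_class 4 (H 3))"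
proof -
  interpret kauffman_relations "kauffman_monoid 4" 4 "gen_class 4 C" "\<lambda>i. gen_class 4 (H i)"
    by (rule kauffman_relations_kauffman_monoid)
  show ?thesis
    by unfold_locales (rule c_closed h_closed h_commute h_cancel h_square h_c; simp)+
qed

section \<open>Reading off a diagram from two-by-two data\<close>

text \<open>
  The coordinates of the power of the two-by-two model. The coordinate \<open>Fold\<close> carries the image under
  the folding retraction. The coordinate \<open>Probe g h z\<close> relabels top hooks by \<open>g\<close> and bottom hooks by \<open>h\<close>,
  forgets the loops, and gives a letter without through strands the exponent \<open>z\<close> and both labels \<open>True\<close>.
\<close>
datatype probe = Fold | Probe "cap \<Rightarrow> bool" "cap \<Rightarrow> bool" nat

abbreviation everywhere :: "cap \<Rightarrow> bool" where
  "everywhere \<equiv> \<lambda>_. True"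

text \<open>
  With such relabellings, a junction whose two labels are both false certifies that opposite hooks
  meet there.
\<close>
definition separating :: "(cap \<Rightarrow> bool) \<Rightarrow> (cap \<Rightarrow> bool) \<Rightarrow> bool" where
  "separating g h \<longleftrightarrow> (\<forall>j k. \<not> h j \<longrightarrow> \<not> g k \<longrightarrow> opposite j k)"

text \<open>
  For the coordinates of a product of letters, the surplus is twice the number of junctions at which
  both labels are false (letters that are powers of \<open>c\<close> being skipped) plus the number of letters
  without through strands. The latter are counted
  because \<open>z\<close> is \<open>1\<close> in just one of the four terms.
\<close>
definition surplus ::
  "((cap \<Rightarrow> bool) \<Rightarrow> (cap \<Rightarrow> bool) \<Rightarrow> nat \<Rightarrow> nat) \<Rightarrow> (cap \<Rightarrow> bool) \<Rightarrow> (cap \<Rightarrow> bool) \<Rightarrow> int" where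
  "surplus E g h = int (E g h 0) + int (E everywhere everywhere 1)
     - int (E g everywhere 0) - int (E everywhere h 0)"

text \<open>
  The first labels \<open>p g\<close> and the last labels \<open>q h\<close> are recorded as functions of the relabelling: if
  through strands are lost, these labels still depend on the hooks of the outermost letters, about
  which the product diagram retains too little.
\<close>
definition tracks :: "(probe \<Rightarrow> cell) \<Rightarrow> ((cap \<Rightarrow> bool) \<Rightarrow> (cap \<Rightarrow> bool) \<Rightarrow> nat \<Rightarrow> nat) \<Rightarrow>
    ((cap \<Rightarrow> bool) \<Rightarrow> bool) \<Rightarrow> ((cap \<Rightarrow> bool) \<Rightarrow> bool) \<Rightarrow> bool" where
  "tracks r E p q \<longleftrightarrow> (\<forall>g h z. r (Probe g h z) = Cell (E g h z) (p g) (q h)) \<and>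
     p everywhere \<and> q everywhere \<and> (\<forall>g h. separating g h \<longrightarrow> surplus E g h \<ge> 0)"

text \<open>
  The folding retraction takes \<open>h\<^sub>1 h\<^sub>3\<close> to \<open>h\<^sub>1 h\<^sub>1 = c h\<^sub>1\<close>, hence the exponent \<open>k + 1\<close> in the last case.
\<close>
fun reads :: "diagram \<Rightarrow> (probe \<Rightarrow> cell) \<Rightarrow> bool" where
  "reads (Loops k) r \<longleftrightarrow> r Fold = Scalar k \<and> (\<forall>g h z. r (Probe g h z) = Scalar 0)"
| "reads (Through k i j) r \<longleftrightarrow> r Fold = Cell k (fold_cap i) (fold_cap j) \<and>
     (\<exists>E. tracks r E (\<lambda>g. g i) (\<lambda>h. h j) \<and> (\<forall>g h. separating g h \<longrightarrow> surplus E g h = 0))"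
| "reads (Closed k a b) r \<longleftrightarrow> r Fold = Cell (k + 1) a b \<and>
     (\<exists>E p q. tracks r E p q \<and> (\<exists>g h. separating g h \<and> surplus E g h > 0))"

lemma tracks_scalar:
  assumes "tracks r E p q" "\<And>g h z. s (Probe g h z) = Scalar 0"
  shows "tracks (\<lambda>i. cell_mult (s i) (r i)) E p q" "tracks (\<lambda>i. cell_mult (r i) (s i)) E p q"
  using assms by (simp_all add: tracks_def)

definition joined_exponent ::
  "((cap \<Rightarrow> bool) \<Rightarrow> (cap \<Rightarrow> bool) \<Rightarrow> nat \<Rightarrow> nat) \<Rightarrow> ((cap \<Rightarrow> bool) \<Rightarrow> bool) \<Rightarrow>
   ((cap \<Rightarrow> bool) \<Rightarrow> (cap \<Rightarrow> bool) \<Rightarrow> nat \<Rightarrow> nat) \<Rightarrow> ((cap \<Rightarrow> bool) \<Rightarrow> bool) \<Rightarrow>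
   (cap \<Rightarrow> bool) \<Rightarrow> (cap \<Rightarrow> bool) \<Rightarrow> nat \<Rightarrow> nat" where
  "joined_exponent E q E' p' g h z = E g h z + E' g h z + of_bool (q h = p' g)"

text \<open>
  The identity \<open>[x = y] + 1 - [x] - [y] = 2 [\<not> x \<and> \<not> y]\<close> at the junction.
\<close>
lemma surplus_joined:
  assumes "q everywhere" "p' everywhere"
  shows "surplus (joined_exponent E q E' p') g h =
    surplus E g h + surplus E' g h + (if q h \<or> p' g then 0 else 2)"
  using assms by (auto simp: surplus_def joined_exponent_def)

lemma tracks_mult:
  assumes "tracks r E p q" "tracks r' E' p' q'"
  shows "tracks (\<lambda>i. cell_mult (r i) (r' i)) (joined_exponent E q E' p') p q'"
  using assms unfolding tracks_def by (auto simp: surplus_joined) (simp_all add: joined_exponent_def)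

lemma tracks_everywhere: "tracks r E p q \<Longrightarrow> p everywhere \<and> q everywhere"
  and tracks_surplus: "tracks r E p q \<Longrightarrow> separating g h \<Longrightarrow> surplus E g h \<ge> 0"
  by (simp_all add: tracks_def)

lemma reads_exists: "\<exists>r. reads t r"
proof (cases t)
  case (Loops k)
  then show ?thesis
    by (intro exI[of _ "\<lambda>x. case x of Fold \<Rightarrow> Scalar k | Probe g h z \<Rightarrow> Scalar 0"]) simp
next
  case (Through k i j)
  then show ?thesis
    by (intro exI[of _ "\<lambda>x. case x of Fold \<Rightarrow> Cell k (fold_cap i) (fold_cap j)
          | Probe g h z \<Rightarrow> Cell 0 (g i) (h j)"])
       (auto simp: tracks_def surplus_def intro!: exI[of _ "\<lambda>_ _ _. 0"])
next
  case (Closed k a b)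
  let ?r = "\<lambda>x. case x of Fold \<Rightarrow> Cell (k + 1) a b | Probe g h z \<Rightarrow> Cell z True True"
  have "tracks ?r (\<lambda>_ _ z. z) (\<lambda>_. True) (\<lambda>_. True)"
    "separating everywhere everywhere" "surplus (\<lambda>_ _ z. z) everywhere everywhere > 0"
    by (simp_all add: tracks_def surplus_def separating_def)
  then have "reads t ?r" unfolding Closed reads.simps by fastforce
  then show ?thesis by (rule exI[of _ ?r])
qed

text \<open>
  Through strands that are lost stay lost: the surplus is additive up to a nonnegative term, so a
  positive contribution from a factor or from the junction survives.
\<close>
lemma reads_closed_mult:
  assumes "tracks r E p q" "tracks r' E' p' q'" "separating g h"
    and "surplus E g h > 0 \<or> surplus E' g h > 0 \<or> \<not> q h \<and> \<not> p' g"
  shows "\<exists>E p q. tracks (\<lambda>i. cell_mult (r i) (r' i)) E p q \<and> (\<exists>g h. separating g h \<and> surplus E g h > 0)"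
proof -
  have "surplus (joined_exponent E q E' p') g h > 0"
    using assms tracks_everywhere[OF assms(1)] tracks_everywhere[OF assms(2)]
      tracks_surplus[OF assms(1,3)] tracks_surplus[OF assms(2,3)]
    by (auto simp: surplus_joined)
  then show ?thesis using tracks_mult[OF assms(1,2)] assms(3) by blast
qed

lemma reads_mult:
  assumes "reads s r" "reads t r'"
  shows "reads (diagram_mult s t) (\<lambda>i. cell_mult (r i) (r' i))"
proof (cases s)
  case s: (Loops k)
  then have "\<And>g h z. r (Probe g h z) = Scalar 0" using assms by simp
  then show ?thesis
    using assms s tracks_scalar(1)[of r'] by (cases t) (simp_all, blast+)
next
  case s: (Through k i j)
  then obtain E where E: "tracks r E (\<lambda>g. g i) (\<lambda>h. h j)"
      "\<And>g h. separating g h \<Longrightarrow> surplus E g h = 0" and r: "r Fold = Cell k (fold_cap i) (fold_cap j)"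
    using assms by auto
  show ?thesis
  proof (cases t)
    case (Loops l)
    then show ?thesis
      using assms s tracks_scalar(2)[OF E(1), of r'] E(2) by (simp, blast)
  next
    case t: (Through l i' j')
    then obtain E' where E': "tracks r' E' (\<lambda>g. g i') (\<lambda>h. h j')"
      "\<And>g h. separating g h \<Longrightarrow> surplus E' g h = 0" and r': "r' Fold = Cell l (fold_cap i') (fold_cap j')"
      using assms by auto
    show ?thesis
    proof (cases "opposite j i'")
      case True
      \<comment> \<open>these labels are both false at the meeting hooks \<open>j\<close> and \<open>i'\<close> only\<close>
      have "separating (\<lambda>k. k \<noteq> i') (\<lambda>k. k \<noteq> j)" using True by (simp add: separating_def)
      then have "\<exists>E p q. tracks (\<lambda>i. cell_mult (r i) (r' i)) E p q \<and>
          (\<exists>g h. separating g h \<and> surplus E g h > 0)"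
        by (intro reads_closed_mult[OF E(1) E'(1)]) auto
      moreover have "fold_cap j = fold_cap i'" using True by (auto simp: opposite_def)
      ultimately show ?thesis using s t True r r' by simp
    next
      case False
      have "surplus (joined_exponent E (\<lambda>h. h j) E' (\<lambda>g. g i')) g h = 0" if "separating g h" for g h
        using E(2)[OF that] E'(2)[OF that] False that by (auto simp: surplus_joined separating_def)
      moreover have "fold_cap j = fold_cap i' \<longleftrightarrow> j = i'"
        using False by (cases j; cases i') (auto simp: opposite_def)
      ultimately show ?thesis using s t False r r' tracks_mult[OF E(1) E'(1)] by auto
    qed
  next
    case t: (Closed l a b)
    then show ?thesis using assms s r reads_closed_mult[OF E(1)] by fastforce
  qed
next
  case s: (Closed k a b)
  then obtain E p q g h where E: "tracks r E p q" "separating g h" "surplus E g h > 0"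
      and r: "r Fold = Cell (k + 1) a b"
    using assms by auto
  show ?thesis
  proof (cases t)
    case (Loops l)
    then show ?thesis
      using assms s tracks_scalar(2)[OF E(1), of r'] E by (simp, blast)
  next
    case t: (Through l i j)
    then show ?thesis using assms s r reads_closed_mult[OF E(1) _ E(2)] E(3) by fastforce
  next
    case t: (Closed l a' b')
    then show ?thesis using assms s r reads_closed_mult[OF E(1) _ E(2)] E(3) by fastforce
  qed
qed

lemma tracks_unique:
  assumes "tracks r E p q" "tracks r E' p' q'"
  shows "E = E'" "p = p'" "q = q'"
  using assms by (auto simp: tracks_def fun_eq_iff)

text \<open>
  The surplus tells diagrams with through strands from those without. Among the former, labels that
  single out one position recover the hooks, and the folded diagram supplies the exponent; the latter
  are determined by their folded diagram.
\<close>
lemma reads_functional: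
  assumes "reads s r" "reads t r"
  shows "s = t"
proof -
  have no_overlap: False
    if "tracks r E p q" "tracks r E' p' q'" "\<And>g h. separating g h \<Longrightarrow> surplus E g h = 0"
      "separating g h" "surplus E' g h > 0" for E E' p p' q q' g h
    using tracks_unique(1)[OF that(1,2)] that(3-5) by force
  show ?thesis
  proof (cases s; cases t)
    fix k i j l i' j' assume st: "s = Through k i j" "t = Through l i' j'"
    then obtain E E' where tr: "tracks r E (\<lambda>g. g i) (\<lambda>h. h j)" "tracks r E' (\<lambda>g. g i') (\<lambda>h. h j')"
      using assms by auto
    have "i = i'" using fun_cong[OF tracks_unique(2)[OF tr], of "\<lambda>k. k = i"] by simp
    moreover have "j = j'" using fun_cong[OF tracks_unique(3)[OF tr], of "\<lambda>k. k = j"] by simp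
    ultimately show ?thesis using assms st by simp
  next
    fix k i j l a b assume "s = Through k i j" "t = Closed l a b"
    then show ?thesis using assms no_overlap by simp blast
  next
    fix k i j l a b assume "s = Closed l a b" "t = Through k i j"
    then show ?thesis using assms no_overlap by simp blast
  qed (use assms in auto)
qed

lemma identity_holds_cell_monoid_imp_K4:
  assumes w: "w \<in> carrier (free_semigroup X)" "w' \<in> carrier (free_semigroup X)"
    and holds: "identity_holds X cell_monoid w w'"
  shows "identity_holds X (kauffman_monoid 4) w w'"
proof -
  interpret four_strand_relations "kauffman_monoid 4" "gen_class 4 C" "gen_class 4 (H 1)"
    "gen_class 4 (H 2)" "gen_class 4 (H 3)"
    by (rule four_strand_relations_K4)
  let ?rel = "\<lambda>x r. \<exists>t. x = realize t \<and> reads t r"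
  show ?thesis
  proof (rule identity_holds_divisor[where R = ?rel, OF monoid_cell_monoid _ _ _ _ w holds])
    fix x assume "x \<in> carrier (kauffman_monoid 4)"
    then obtain u where u: "u \<in> lists (kauffman_gens 4)"
      "x = word_class (kauffman_gens 4) (kauffman_rels 4) u"
      by (auto simp: kauffman_monoid_def carrier_presented_monoid)
    have "{1..4 - 1} = {1, 2, 3 :: nat}" by auto
    then have "kauffman_gens 4 = {C, H 1, H 2, H 3}" by (simp only: kauffman_gens_def image_insert image_empty)
    then have "gen_class 4 g \<in> gen_class 4 ` {C, H 1, H 2, H 3}" if "g \<in> set u" for g
      using u(1) that by (intro imageI) auto
    then have "gen_class 4 g \<in> {gen_class 4 C, gen_class 4 (H 1), gen_class 4 (H 2), gen_class 4 (H 3)}"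
      if "g \<in> set u" for g
      using that by (simp only: image_insert image_empty)
    then have "word_eval (kauffman_monoid 4) (gen_class 4) u \<in> range realize"
      by (rule word_eval_realized)
    then have "x \<in> range realize"
      using u by (simp add: kauffman_monoid_def word_eval_generators)
    then show "\<exists>r. ?rel x r" using reads_exists by blast
  next
    fix x x' r r' assume "?rel x r" "?rel x' r'"
    then obtain t t' where "x = realize t" "reads t r" "x' = realize t'" "reads t' r'" by blast
    then have "x \<otimes>\<^bsub>kauffman_monoid 4\<^esub> x' = realize (diagram_mult t t')"
      "reads (diagram_mult t t') (\<lambda>i. cell_mult (r i) (r' i))"
      by (simp_all only: realize_mult reads_mult)
    then show "?rel (x \<otimes>\<^bsub>kauffman_monoid 4\<^esub> x') (\<lambda>i. r i \<otimes>\<^bsub>cell_monoid\<^esub> r' i)"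
      by auto
  next
    fix x x' r assume "?rel x r" "?rel x' r"
    then show "x = x'" using reads_functional by blast
  qed simp
qed

theorem theorem3:
  fixes X :: "'x set"
  assumes "countable X" and "infinite X"
  shows "equationally_equivalent X (kauffman_monoid 3) (kauffman_monoid 4)"
  unfolding equationally_equivalent_def
  using identity_holds_K3_imp_cell_monoid identity_holds_cell_monoid_imp_K4 identity_holds_K4_imp_K3
  by blast

end
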